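(* Let $V$ be a finite-dimensional vector space over a field $F$ (of arbitrary characteristic), let $S\leq V$ be a subspace, and let $Q\colon S\to F$ be a quadratic form with polar form $B$ and radical $R$ of $B$, such that $Q(x)=0$ for all $x\in R\setminus\{0\}$. Let $\hat Q\colon\hat S\to F$ be the dual quadratic form of $Q$, where $\hat S=\operatorname{ann}_V(R)$. Then the following hold: (a) The relation $\lozenge$ on $\hat S\times S$, which arises from the polar form $B$ of $Q$, has the relation $\hat\lozenge$ on $S\times\hat S$, which arises from the polar form $\hat B$ of $\hat Q$, as its converse relation; that is, for all $a^*\in\hat S$ and $x\in S$, $a^*\mathrel{\lozenge}x$ holds if and only if $x\mathrel{\hat\lozenge}a^*$. (b) The dual quadratic form of $\hat Q$ coincides with $Q$.
   Context: A quadratic form $Q\colon S\to F$ on an $F$-vector space $S$ is a map with $Q(cx)=c^2Q(x)$ for all $c\in F$, $x\in S$, and such that its polar form $B\colon S\times S\to F$, $B(x,y):=Q(x+y)-Q(x)-Q(y)$, is bilinear. The radical of $B$ is $R:=\{x\in S\mid B(x,y)=0\text{ for all }y\in S\}$. $V^*$ is the dual space of $V$, $\langle a^*,x\rangle_V:=a^*(x)$ for $a^*\in V^*$, $x\in V$, and for $M\subseteq V$, $\operatorname{ann}_V(M):=\{a^*\in V^*\mid\langle a^*,m\rangle_V=0\text{ for all }m\in M\}$. The dual of $V^*$ is identified with $V$ in the canonical way, so for $M\subseteq V^*$, $\operatorname{ann}_{V^*}(M)=\{x\in V\mid\langle a^*,x\rangle_V=0\text{ for all }a^*\in M\}$. Put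 $\hat S:=\operatorname{ann}_V(R)\leq V^*$ and $\hat R:=\operatorname{ann}_V(S)\leq\hat S$. A linear form $a^*\in\hat S$ is $B$-linked to $x\in S$, written $a^*\mathrel{\lozenge}x$, if and only if $\langle a^*,y\rangle_V=B(x,y)$ for all $y\in S$. Dual quadratic form: if $Q$ vanishes on the radical $R$ of its polar form, there is a unique mapping $\hat Q\colon\hat S\to F$ such that $a^*\mathrel{\lozenge}x$ implies $\hat Q(a^* )=Q(x)$ (for $a^*\in\hat S$, $x\in S$); it is a quadratic form and is called the dual quadratic form of $Q$. Its polar form is denoted $\hat B$. The radical of $\hat B$ is $\hat R$ and $\hat Q$ vanishes on $\hat R$, so the same construction can be applied to $\hat Q$ on the subspace $\hat S$ of $V^*$ (with $V^*$ in the role of $V$, and $V$ in the role of the dual space of $V^*$). The domain of the dual quadratic form of $\hat Q$ is $\operatorname{ann}_{V^*}(\hat R)=S$, and the linking relation arising from $\hat B$ is the relation $\hat\lozenge$ on $S\times\hat S$ given by: $y\mathrel{\hat\lozenge}b^*$ if and only if $\langle a^*,y\rangle_V=\hat B(a^*,b^* )$ for all $a^*\in\hat S$. The dual quadratic form of $\hat Q$ is the unique mapping $S\to F$ whose value at $y$ is $\hat Q(b^* )$ whenever $y\mathrel{\hat\lozenge}b^*$. *)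

theory Defs
  imports Complex_Main "HOL-Library.FuncSet" "HOL-Library.Function_Algebras"
begin

definition dual_space :: "('a::field \<Rightarrow> 'v::ab_group_add \<Rightarrow> 'v) \<Rightarrow> ('v \<Rightarrow> 'a) set" where
  "dual_space scale = {f. Vector_Spaces.linear scale (*) f}"

definition polar :: "('v::ab_group_add \<Rightarrow> 'a::field) \<Rightarrow> 'v \<Rightarrow> 'v \<Rightarrow> 'a" where
  "polar Q x y = Q (x + y) - Q x - Q y"

definition quadratic_form_on ::
  "('a::field \<Rightarrow> 'v::ab_group_add \<Rightarrow> 'v) \<Rightarrow> 'v set \<Rightarrow> ('v \<Rightarrow> 'a) \<Rightarrow> bool" where
  "quadratic_form_on scale S Q \<longleftrightarrow>
     (\<forall>c. \<forall>x\<in>S. Q (scale c x) = c\<^sup>2 * Q x) \<and>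
     (\<forall>x\<in>S. \<forall>y\<in>S. \<forall>z\<in>S. polar Q (x + y) z = polar Q x z + polar Q y z) \<and>
     (\<forall>x\<in>S. \<forall>y\<in>S. \<forall>z\<in>S. polar Q x (y + z) = polar Q x y + polar Q x z) \<and>
     (\<forall>c. \<forall>x\<in>S. \<forall>y\<in>S. polar Q (scale c x) y = c * polar Q x y) \<and>
     (\<forall>c. \<forall>x\<in>S. \<forall>y\<in>S. polar Q x (scale c y) = c * polar Q x y)"

definition radical :: "'v set \<Rightarrow> ('v \<Rightarrow> 'v \<Rightarrow> 'a::field) \<Rightarrow> 'v set" where
  "radical S B = {x \<in> S. \<forall>y\<in>S. B x y = 0}"

text \<open>
  The construction of the dual quadratic form is carried out twice: on a subspace of \<open>V\<close>, and
  then on a subspace of \<open>V\<^sup>*\<close>, whose dual space is identified with \<open>V\<close>.  The definitions below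
  therefore take as arguments a set \<open>D\<close>, playing the role of the dual space, and the evaluation
  map \<open>p\<close>, where \<open>p a x\<close> is the value of the linear form \<open>a \<in> D\<close> at \<open>x\<close>.  For subspaces of
  \<open>V\<close>, these are \<open>V\<^sup>*\<close> and \<open>\<lambda>a x. a x\<close>; for subspaces of \<open>V\<^sup>*\<close>, they are the whole of \<open>V\<close> and
  \<open>\<lambda>x a. a x\<close>.
\<close>

definition annihilator :: "'d set \<Rightarrow> ('d \<Rightarrow> 'v \<Rightarrow> 'a::field) \<Rightarrow> 'v set \<Rightarrow> 'd set" where
  "annihilator D p M = {a \<in> D. \<forall>m\<in>M. p a m = 0}"

definition dual_form_domain ::
  "'d set \<Rightarrow> ('d \<Rightarrow> 'v::ab_group_add \<Rightarrow> 'a::field) \<Rightarrow> 'v set \<Rightarrow> ('v \<Rightarrow> 'a) \<Rightarrow> 'd set" where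
  "dual_form_domain D p S Q = annihilator D p (radical S (polar Q))"

definition linking ::
  "'d set \<Rightarrow> ('d \<Rightarrow> 'v::ab_group_add \<Rightarrow> 'a::field) \<Rightarrow> 'v set \<Rightarrow> ('v \<Rightarrow> 'a) \<Rightarrow> ('d \<times> 'v) set" where
  "linking D p S Q =
     {(a, x). a \<in> dual_form_domain D p S Q \<and> x \<in> S \<and> (\<forall>y\<in>S. p a y = polar Q x y)}"

text \<open>
  A map defined on a subset of a type is represented by the total function that is
  \<open>undefined\<close> outside this subset.  The description below is meaningful if \<open>Q\<close> vanishes on the
  radical of its polar form.
\<close>

definition dual_quadratic_form ::
  "'d set \<Rightarrow> ('d \<Rightarrow> 'v::ab_group_add \<Rightarrow> 'a::field) \<Rightarrow> 'v set \<Rightarrow> ('v \<Rightarrow> 'a) \<Rightarrow> 'd \<Rightarrow> 'a" where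
  "dual_quadratic_form D p S Q =
     (THE q. q \<in> extensional (dual_form_domain D p S Q) \<and>
             (\<forall>a x. (a, x) \<in> linking D p S Q \<longrightarrow> q a = Q x))"

end

theory Submission
  imports Defs
begin

text \<open>
  Every linear form in \<open>Shat\<close> is linked to some vector of \<open>S\<close>, because it vanishes on the common
  kernel of the finitely many forms \<open>B b\<close>, with \<open>b\<close> in a basis of \<open>S\<close>, and hence is a combination
  of them; conversely, every vector of \<open>S\<close> is linked to some form in \<open>Shat\<close>, because linear forms
  on \<open>S\<close> extend to \<open>V\<close>.  If \<open>a\<close> is linked to \<open>x\<close> and \<open>b\<close> to \<open>y\<close>, then \<open>a + b\<close> is linked to
  \<open>x + y\<close>, so that the polar form of the dual form satisfies \<open>Bhat a b = B x y = a y\<close>.  Everything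
  else follows from this formula.
\<close>

lemma polar_commute: "polar Q x y = polar Q y x"
  by (simp add: polar_def add.commute)

section \<open>Linear forms: separation and extension\<close>

context vector_space
begin

lemma dual_space_iff:
  "f \<in> dual_space scale \<longleftrightarrow>
    (\<forall>x y. f (x + y) = f x + f y) \<and> (\<forall>c x. f (scale c x) = c * f x)"
proof -
  interpret field_pair: vector_space_pair scale "(*) :: 'a \<Rightarrow> 'a \<Rightarrow> 'a"
    by unfold_locales (simp_all add: algebra_simps)
  show ?thesis
    by (auto simp: dual_space_def Vector_Spaces.linear_iff
        intro: vector_space_axioms field_pair.vs2.vector_space_axioms)
qed

lemma dual_space_add:
  assumes "f \<in> dual_space scale" and "g \<in> dual_space scale"
  shows "f + g \<in> dual_space scale"
  using assms by (simp add: dual_space_iff algebra_simps)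

text \<open>A basis of \<open>S\<close> together with \<open>x\<close> is independent, so the values
  0 and 1 can be prescribed on it. Needed to see that the domain of the bidual form is no larger
  than \<open>S\<close>.\<close>

lemma separating_linear_form_exists:
  assumes "subspace S" and "x \<notin> S"
  shows "\<exists>f \<in> dual_space scale. (\<forall>y\<in>S. f y = 0) \<and> f x = 1"
proof -
  interpret field_pair: vector_space_pair scale "(*) :: 'a \<Rightarrow> 'a \<Rightarrow> 'a"
    by unfold_locales (simp_all add: algebra_simps)
  obtain C where C: "C \<subseteq> S" "independent C" "S \<subseteq> span C"
    by (rule maximal_independent_subset[of S])
  then have "span C = S"
    using assms(1) span_minimal by blast
  then have "x \<notin> span C"
    using assms(2) by simp
  then have "independent (insert x C)"
    using C(2) by (simp add: independent_insertI)
  then obtain f where f: "Vector_Spaces.linear scale (*) f"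
      and fv: "\<forall>y\<in>insert x C. f y = (if y = x then 1 else 0)"
    using field_pair.linear_independent_extend[of "insert x C" "\<lambda>y. if y = x then 1 else 0"] by blast
  have "f y = 0" if "y \<in> S" for y
  proof (rule field_pair.linear_eq_0_on_span[OF f])
    show "f c = 0" if "c \<in> C" for c
      using that fv \<open>x \<notin> span C\<close> span_base by auto
    show "y \<in> span C"
      using that C(3) by blast
  qed
  with f fv show ?thesis
    by (auto simp: dual_space_def)
qed

lemma linear_form_extension:
  assumes S: "subspace S"
    and add: "\<And>x y. x \<in> S \<Longrightarrow> y \<in> S \<Longrightarrow> g (x + y) = g x + g y"
    and scale: "\<And>c x. x \<in> S \<Longrightarrow> g (scale c x) = c * g x"
  shows "\<exists>f \<in> dual_space scale. \<forall>x\<in>S. f x = g x"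
proof -
  interpret self_pair: vector_space_pair scale scale ..
  \<comment> \<open>A left inverse of the identity on \<open>S\<close> with values in
    \<open>S\<close> is a linear projection onto \<open>S\<close>.\<close>
  obtain p where p: "range p \<subseteq> S" "Vector_Spaces.linear scale scale p" "\<forall>x\<in>S. p x = x"
    using self_pair.linear_exists_left_inverse_on[OF linear_id S] by (auto simp: id_def)
  have pS: "p x \<in> S" for x
    using p(1) by blast
  have "g \<circ> p \<in> dual_space scale"
    using p(2) pS by (simp add: dual_space_iff Vector_Spaces.linear_iff add scale)
  with p(3) show ?thesis
    by (auto intro!: bexI[of _ "g \<circ> p"])
qed

end

locale quadratic_form_vanishing_on_radical = finite_dimensional_vector_space scale Basis
  for scale :: "'a::field \<Rightarrow> 'v::ab_group_add \<Rightarrow> 'v" and Basis :: "'v set" +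
  fixes S :: "'v set" and Q :: "'v \<Rightarrow> 'a"
  assumes subspace_S: "subspace S"
    and quadratic_form: "quadratic_form_on scale S Q"
    and vanishing: "x \<in> radical S (polar Q) \<Longrightarrow> Q x = 0"
begin

abbreviation "B \<equiv> polar Q"
abbreviation "R \<equiv> radical S B"
abbreviation "Shat \<equiv> annihilator (dual_space scale) (\<lambda>a x. a x) R"
abbreviation "linked \<equiv> linking (dual_space scale) (\<lambda>a x. a x) S Q"
abbreviation "Qhat \<equiv> dual_quadratic_form (dual_space scale) (\<lambda>a x. a x) S Q"
abbreviation "Bhat \<equiv> polar Qhat"

lemma polar_linear:
  assumes "x \<in> S" and "y \<in> S" and "z \<in> S"
  shows "B (x + y) z = B x z + B y z"
    and "B x (y + z) = B x y + B x z"
    and "B (scale c x) y = c * B x y"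
    and "B x (scale c y) = c * B x y"
  using quadratic_form assms unfolding quadratic_form_on_def by blast+

lemma polar_zero: "x \<in> S \<Longrightarrow> B x 0 = 0" "x \<in> S \<Longrightarrow> B 0 x = 0"
  using polar_linear(4)[of x x x 0] by (simp_all add: polar_commute[of Q 0])

section \<open>The linking relation between forms and vectors\<close>

lemma linked_iff:
  "(a, x) \<in> linked \<longleftrightarrow> a \<in> Shat \<and> x \<in> S \<and> (\<forall>y\<in>S. a y = B x y)"
  by (simp add: linking_def dual_form_domain_def)

text \<open>A form vanishing on the common kernel of finitely many forms is a combination of them;
  linearity in the first argument merges a combination of the \<open>B c\<close> into a single
  \<open>B x\<close>.\<close>

lemma form_vanishing_on_common_kernel:
  assumes "finite C" and "C \<subseteq> S" and "a \<in> dual_space scale"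
    and "\<And>y. y \<in> S \<Longrightarrow> \<forall>c\<in>C. B c y = 0 \<Longrightarrow> a y = 0"
  shows "\<exists>x\<in>S. \<forall>y\<in>S. a y = B x y"
proof -
  \<comment> \<open>Generalised to maps linear on \<open>S\<close> only: the induction replaces
    \<open>g\<close> by \<open>g - k * B d\<close>, and \<open>B d\<close> need not be linear
    outside \<open>S\<close>.\<close>
  have "\<exists>x\<in>S. \<forall>y\<in>S. g y = B x y"
    if "\<And>y z. y \<in> S \<Longrightarrow> z \<in> S \<Longrightarrow> g (y + z) = g y + g z"
      and "\<And>k y. y \<in> S \<Longrightarrow> g (scale k y) = k * g y"
      and "\<And>y. y \<in> S \<Longrightarrow> \<forall>c\<in>C. B c y = 0 \<Longrightarrow> g y = 0" for g
    using assms(1,2) that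
  proof (induction C arbitrary: g rule: finite_induct)
    case empty
    then show ?case
      using subspace_0[OF subspace_S] polar_zero by (intro bexI[of _ 0]) auto
  next
    case (insert d D)
    have d: "d \<in> S" and D: "D \<subseteq> S"
      using insert.prems(1) by auto
    define K where "K = {y \<in> S. \<forall>c\<in>D. B c y = 0}"
    show ?case
    proof (cases "\<forall>y\<in>K. B d y = 0")
      case True
      show ?thesis
      proof (rule insert.IH[OF D insert.prems(2,3)])
        show "g y = 0" if "y \<in> S" "\<forall>c\<in>D. B c y = 0" for y
          using that True insert.prems(4)[of y] by (auto simp: K_def)
      qed auto
    next
      case False
      then obtain z where z: "z \<in> S" "\<forall>c\<in>D. B c z = 0" "B d z \<noteq> 0"
        by (auto simp: K_def)
      \<comment> \<open>This multiple makes \<open>g - k * B d\<close> vanish at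
        \<open>z\<close>.\<close>
      define k where "k = g z / B d z"
      have "\<exists>x\<in>S. \<forall>y\<in>S. g y - k * B d y = B x y"
      proof (rule insert.IH[OF D])
        fix y assume y: "y \<in> S" "\<forall>c\<in>D. B c y = 0"
        \<comment> \<open>Adding this multiple of \<open>z\<close> moves \<open>y\<close> into the
          kernel of \<open>B d\<close>, and it stays in the other kernels because \<open>z\<close>
          lies in them.\<close>
        define t where "t = - (B d y / B d z)"
        have tz: "scale t z \<in> S"
          using z(1) subspace_scale[OF subspace_S] by blast
        have "B c (y + scale t z) = 0" if "c \<in> insert d D" for c
        proof -
          have c: "c \<in> S"
            using that d D by blast
          have "B c (y + scale t z) = B c y + t * B c z"
            using polar_linear(2)[OF c y(1) tz] polar_linear(4)[OF c z(1) z(1)] by simp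
          then show ?thesis
            using that y(2) z(2,3) by (auto simp: t_def)
        qed
        then have "g (y + scale t z) = 0"
          using insert.prems(4) y(1) tz subspace_add[OF subspace_S] by blast
        then have "g y + t * g z = 0"
          using insert.prems(2,3) y(1) z(1) tz by simp
        then show "g y - k * B d y = 0"
          by (simp add: t_def k_def mult.commute)
      next
        fix y y' assume "y \<in> S" "y' \<in> S"
        then show "g (y + y') - k * B d (y + y') = g y - k * B d y + (g y' - k * B d y')"
          using d insert.prems(2) by (simp add: polar_linear algebra_simps)
      next
        fix c y assume "y \<in> S"
        then show "g (scale c y) - k * B d (scale c y) = c * (g y - k * B d y)"
          using d insert.prems(3) polar_linear(4)[OF d \<open>y \<in> S\<close> d]
          by (simp add: algebra_simps)
      qed
      then obtain x where x: "x \<in> S" "\<forall>y\<in>S. g y - k * B d y = B x y"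
        by blast
      have kd: "scale k d \<in> S"
        using d subspace_scale[OF subspace_S] by blast
      have "g y = B (x + scale k d) y" if y: "y \<in> S" for y
        using x(2)[rule_format, OF y] polar_linear(1)[OF x(1) kd y] polar_linear(3)[OF d y y]
        by (simp add: algebra_simps)
      then show ?thesis
        using x(1) kd subspace_add[OF subspace_S] by blast
    qed
  qed
  then show ?thesis
    using assms(3,4) unfolding dual_space_iff by blast
qed

lemma linked_vector_exists:
  assumes a: "a \<in> Shat"
  shows "\<exists>x. (a, x) \<in> linked"
proof -
  obtain C where C: "C \<subseteq> S" "independent C" "S \<subseteq> span C"
    by (rule maximal_independent_subset[of S])
  have "a y = 0" if y: "y \<in> S" "\<forall>c\<in>C. B c y = 0" for y
  proof -
    \<comment> \<open>Membership in \<open>S\<close> is carried along because bilinearity is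
      available on \<open>S\<close> only.\<close>
    have "x \<in> S \<and> B x y = 0" if "x \<in> span C" for x
      using that
    proof (induction rule: span_induct_alt)
      case base
      then show ?case
        using subspace_0[OF subspace_S] polar_zero y by simp
    next
      case (step k c z)
      have c: "c \<in> S" and kc: "scale k c \<in> S"
        using step C(1) subspace_scale[OF subspace_S] by auto
      then show ?case
        using step y subspace_add[OF subspace_S] polar_linear(1)[of "scale k c" z y]
          polar_linear(3)[OF c y(1) y(1)] by simp
    qed
    then have "y \<in> R"
      using y C(3) by (auto simp: radical_def polar_commute[of Q y])
    then show ?thesis
      using a by (simp add: annihilator_def)
  qed
  then show ?thesis
    using form_vanishing_on_common_kernel[of C a] finiteI_independent[OF C(2)] C(1) a
    by (auto simp: linked_iff annihilator_def)
qed

lemma linked_form_exists: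
  assumes x: "x \<in> S"
  shows "\<exists>a. (a, x) \<in> linked"
proof -
  obtain a where a: "a \<in> dual_space scale" "\<forall>y\<in>S. a y = B x y"
    using linear_form_extension[OF subspace_S, of "B x"] polar_linear(2,4) x by blast
  moreover have "a y = 0" if "y \<in> R" for y
    using that x a by (auto simp: radical_def polar_commute[of Q x])
  ultimately show ?thesis
    using x by (auto simp: linked_iff annihilator_def)
qed

section \<open>The dual form and its polar form\<close>

lemma form_eq_if_linked_to_same:
  assumes "(a, x) \<in> linked" and "(a, y) \<in> linked"
  shows "Q x = Q y"
proof -
  have x: "x \<in> S" and y: "y \<in> S" and xy: "x - y \<in> S" and eq: "\<forall>z\<in>S. B x z = B y z"
    using assms subspace_diff[OF subspace_S] by (auto simp: linked_iff)
  have "B (x - y) z = 0" if z: "z \<in> S" for z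
    using polar_linear(1)[OF xy y z] eq z by simp
  \<comment> \<open>The second fact gives \<open>Q x = Q (x - y) + Q y\<close>, where the first
    summand is zero by the first fact.\<close>
  then have "x - y \<in> R" and "B (x - y) y = 0"
    using xy y by (auto simp: radical_def)
  then show ?thesis
    using vanishing[of "x - y"] by (simp add: polar_def)
qed

text \<open>Resolves the definite description behind \<open>Qhat\<close>: the value at any chosen
  linked vector is independent of the choice, and uniqueness holds because every form in
  \<open>Shat\<close> is linked to a vector.\<close>

lemma Qhat_linked:
  assumes "(a, x) \<in> linked"
  shows "Qhat a = Q x"
proof -
  define q where "q = (\<lambda>a\<in>Shat. Q (SOME x. (a, x) \<in> linked))"
  have q: "q a = Q x" if "(a, x) \<in> linked" for a x
  proof -
    have "(a, SOME x. (a, x) \<in> linked) \<in> linked"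
      using that by (rule someI)
    then have "Q (SOME x. (a, x) \<in> linked) = Q x"
      using that by (rule form_eq_if_linked_to_same)
    moreover have "a \<in> Shat"
      using that linked_iff by blast
    ultimately show ?thesis
      by (simp only: q_def restrict_apply')
  qed
  have "Qhat = q"
    unfolding dual_quadratic_form_def dual_form_domain_def
  proof (rule the_equality)
    show "q \<in> extensional Shat \<and> (\<forall>a x. (a, x) \<in> linked \<longrightarrow> q a = Q x)"
      using q by (simp add: q_def)
  next
    fix q' assume q': "q' \<in> extensional Shat \<and> (\<forall>a x. (a, x) \<in> linked \<longrightarrow> q' a = Q x)"
    show "q' = q"
    proof (rule extensionalityI[of _ Shat])
      fix a assume "a \<in> Shat"
      then obtain x where "(a, x) \<in> linked"
        using linked_vector_exists by blast
      then show "q' a = q a"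
        using q q' by metis
    qed (use q' in \<open>auto simp: q_def\<close>)
  qed
  then show ?thesis
    using q assms by simp
qed

lemma linked_add:
  assumes "(a, x) \<in> linked" and "(b, y) \<in> linked"
  shows "(a + b, x + y) \<in> linked"
  using assms subspace_add[OF subspace_S] dual_space_add polar_linear(1)
  by (auto simp: linked_iff annihilator_def)

lemma Bhat_linked:
  assumes "(a, x) \<in> linked" and "(b, y) \<in> linked"
  shows "Bhat a b = a y"
proof -
  have "Bhat a b = B x y"
    using assms linked_add by (simp add: polar_def Qhat_linked)
  also have "\<dots> = a y"
    using assms by (simp add: linked_iff)
  finally show ?thesis .
qed

text \<open>\<open>Bhat a b\<close> is the value of \<open>a\<close> at any vector linked to
  \<open>b\<close>, and these vectors exhaust \<open>S\<close> as \<open>b\<close> runs through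
  \<open>Shat\<close>.\<close>

lemma radical_Bhat: "radical Shat Bhat = {a \<in> Shat. \<forall>y\<in>S. a y = 0}"
proof (intro set_eqI iffI)
  fix a assume a: "a \<in> radical Shat Bhat"
  then have "a \<in> Shat"
    by (simp add: radical_def)
  then obtain x where x: "(a, x) \<in> linked"
    using linked_vector_exists by blast
  have "a y = 0" if y: "y \<in> S" for y
  proof -
    obtain b where b: "(b, y) \<in> linked"
      using linked_form_exists[OF y] by blast
    then show ?thesis
      using a Bhat_linked[OF x b] by (auto simp: radical_def linked_iff)
  qed
  with \<open>a \<in> Shat\<close> show "a \<in> {a \<in> Shat. \<forall>y\<in>S. a y = 0}"
    by simp
next
  fix a assume a: "a \<in> {a \<in> Shat. \<forall>y\<in>S. a y = 0}"
  then obtain x where x: "(a, x) \<in> linked"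
    using linked_vector_exists by blast
  have "Bhat a b = 0" if "b \<in> Shat" for b
    using linked_vector_exists[OF that] Bhat_linked[OF x] a by (auto simp: linked_iff)
  with a show "a \<in> radical Shat Bhat"
    by (simp add: radical_def)
qed

section \<open>The construction applied to the dual form\<close>

lemma bidual_domain: "dual_form_domain UNIV (\<lambda>x a. a x) Shat Qhat = S"
proof (intro set_eqI iffI)
  fix x assume x: "x \<in> dual_form_domain UNIV (\<lambda>x a. a x) Shat Qhat"
  show "x \<in> S"
  proof (rule ccontr)
    assume "x \<notin> S"
    then obtain f where f: "f \<in> dual_space scale" "\<forall>y\<in>S. f y = 0" "f x = 1"
      using separating_linear_form_exists[OF subspace_S] by blast
    \<comment> \<open>\<open>f\<close> lies in \<open>Shat\<close> because it vanishes on
      \<open>S\<close>, which contains \<open>R\<close>.\<close>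
    then have "f \<in> radical Shat Bhat"
      unfolding radical_Bhat by (auto simp: annihilator_def radical_def)
    then have "f x = 0"
      using x by (simp add: dual_form_domain_def annihilator_def[of UNIV])
    with f(3) show False
      by simp
  qed
qed (simp add: dual_form_domain_def radical_Bhat annihilator_def[of UNIV])

text \<open>If \<open>b\<close> is linked to \<open>y\<close>, then \<open>Bhat a b = a y\<close>
  and \<open>b x = B x y\<close>. So testing \<open>b x = Bhat a b\<close> for all \<open>b\<close>
  in \<open>Shat\<close> amounts to testing \<open>a y = B x y\<close> for all \<open>y\<close> in
  \<open>S\<close>.\<close>

lemma bidual_linking: "linking UNIV (\<lambda>x a. a x) Shat Qhat = linked\<inverse>"
proof -
  have key: "(\<forall>b\<in>Shat. b x = Bhat a b) \<longleftrightarrow> (a, x) \<in> linked" if x: "x \<in> S" and a: "a \<in> Shat" for x a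
  proof
    assume eq: "\<forall>b\<in>Shat. b x = Bhat a b"
    \<comment> \<open>\<open>z\<close> serves only to evaluate \<open>Bhat a b\<close>; it may
      differ from \<open>x\<close>.\<close>
    obtain z where z: "(a, z) \<in> linked"
      using linked_vector_exists[OF a] by blast
    have "a y = B x y" if y: "y \<in> S" for y
    proof -
      obtain b where b: "(b, y) \<in> linked"
        using linked_form_exists[OF y] by blast
      have "a y = Bhat a b"
        using Bhat_linked[OF z b] by simp
      also have "\<dots> = b x"
        using eq b by (simp add: linked_iff)
      also have "\<dots> = B x y"
        using b x by (simp add: linked_iff polar_commute)
      finally show ?thesis .
    qed
    with a x show "(a, x) \<in> linked"
      by (simp add: linked_iff)
  next
    assume ax: "(a, x) \<in> linked"
    \<comment> \<open>\<open>Bhat_linked\<close> is used with the arguments swapped: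
      \<open>Bhat b a = b x\<close>, since \<open>a\<close> is linked to \<open>x\<close>.\<close>
    show "\<forall>b\<in>Shat. b x = Bhat a b"
      using linked_vector_exists Bhat_linked[OF _ ax] polar_commute[of Qhat a] by metis
  qed
  have "linking UNIV (\<lambda>x a. a x) Shat Qhat =
      {(x, a). x \<in> S \<and> a \<in> Shat \<and> (\<forall>b\<in>Shat. b x = Bhat a b)}"
    by (simp only: linking_def[of UNIV] bidual_domain)
  also have "\<dots> = {(x, a). x \<in> S \<and> a \<in> Shat \<and> (a, x) \<in> linked}"
    using key by (simp only: case_prod_beta cong: conj_cong)
  also have "\<dots> = linked\<inverse>"
    using linked_iff by blast
  finally show ?thesis .
qed

text \<open>By \<open>Qhat_linked\<close>, \<open>Q\<close> itself satisfies the defining condition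
  for the converse relation; uniqueness holds because every vector of \<open>S\<close> is linked to
  a form.\<close>

lemma bidual_form: "dual_quadratic_form UNIV (\<lambda>x a. a x) Shat Qhat = restrict Q S"
  unfolding dual_quadratic_form_def[of UNIV] bidual_domain bidual_linking
proof (rule the_equality)
  show "restrict Q S \<in> extensional S \<and>
      (\<forall>x a. (x, a) \<in> linked\<inverse> \<longrightarrow> restrict Q S x = Qhat a)"
    by (auto simp: Qhat_linked) (simp add: linked_iff)
next
  fix q assume q: "q \<in> extensional S \<and> (\<forall>x a. (x, a) \<in> linked\<inverse> \<longrightarrow> q x = Qhat a)"
  show "q = restrict Q S"
  proof (rule extensionalityI[of _ S])
    fix x assume x: "x \<in> S"
    then obtain a where "(a, x) \<in> linked"
      using linked_form_exists by blast
    then show "q x = restrict Q S x"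
      using q x Qhat_linked by auto
  qed (use q in auto)
qed

end

theorem theorem4p5:
  fixes scale :: "'a::field \<Rightarrow> 'v::ab_group_add \<Rightarrow> 'v"
    and Basis :: "'v set"
    and S R :: "'v set"
    and Q :: "'v \<Rightarrow> 'a"
    and Shat :: "('v \<Rightarrow> 'a) set"
    and Qhat :: "('v \<Rightarrow> 'a) \<Rightarrow> 'a"
  assumes "finite_dimensional_vector_space scale Basis"
    and "module.subspace scale S"
    and "quadratic_form_on scale S Q"
    and "R = radical S (polar Q)"
    and "\<forall>x \<in> R - {0}. Q x = 0"
    and "Shat = annihilator (dual_space scale) (\<lambda>a x. a x) R"
    and "Qhat = dual_quadratic_form (dual_space scale) (\<lambda>a x. a x) S Q"
  shows "linking UNIV (\<lambda>x a. a x) Shat Qhat = (linking (dual_space scale) (\<lambda>a x. a x) S Q)\<inverse> \<and>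
         dual_form_domain UNIV (\<lambda>x a. a x) Shat Qhat = S \<and>
         dual_quadratic_form UNIV (\<lambda>x a. a x) Shat Qhat = restrict Q S"
proof -
  interpret finite_dimensional_vector_space scale Basis
    by (fact assms(1))
  \<comment> \<open>The hypothesis leaves out the zero vector, whose value follows from
    homogeneity.\<close>
  have "Q (scale 0 0) = 0\<^sup>2 * Q 0"
    using assms(3) subspace_0[OF assms(2)] unfolding quadratic_form_on_def by blast
  then have "Q 0 = 0"
    by simp
  then have "Q x = 0" if "x \<in> radical S (polar Q)" for x
    using that assms(4,5) by (cases "x = 0") auto
  then interpret quadratic_form_vanishing_on_radical scale Basis S Q
    by unfold_locales (use assms(2,3) in auto)
  show ?thesis
    unfolding assms(4,6,7) using bidual_linking bidual_domain bidual_form by blast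
qed

end
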